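(* Let $I$ be a compact interval and let $f: I \rightarrow I$ be a continuous onto mapping. For every neighbourhood $U$ of $A(f)$ there exists $M \in \mathbb{N}$ such that for any backward orbit branch $\{x_i\}_{i \leq 0}$ of $f$, $x_i \in I$, at most $M$ of the points $x_i$ lie outside of $U$.
   Context: Let $f: I \to I$ be a continuous map of a compact interval. A preimage sequence of a point $x \in I$ is a sequence $\{x_n\}_{n=0}^{\infty}$ in $I$ such that $f^n(x_n) = x$ for all $n \ge 0$ (no relation between consecutive members is required). The $\alpha$-limit set $\alpha(x)$ of a point $x$ is the set of all limit points of all preimage sequences of $x$, i.e. $y \in \alpha(x)$ if and only if there are a preimage sequence $\{x_n\}_{n=0}^{\infty}$ of $x$ and a strictly increasing sequence of non-negative integers $\{n_k\}$ with $x_{n_k} \to y$. Put $A(f) = \bigcup_{x \in I} \alpha(x)$. A backward orbit branch of a point $x$ is a sequence $\{x_i\}_{i \leq 0}$ in $I$, indexed by the non-positive integers, with $x_0 = x$ and $f(x_{i-1}) = x_{i}$ for all $i \le 0$. A backward orbit branch of $f$ is a backward orbit branch of some point of $I$. A neighbourhood of a set means a subset of $I$ containing an open (relative to $I$) set that contains the given set. *)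

theory Defs
  imports "HOL-Analysis.Analysis"
begin

definition preimage_sequence :: "real set \<Rightarrow> (real \<Rightarrow> real) \<Rightarrow> real \<Rightarrow> (nat \<Rightarrow> real) \<Rightarrow> bool" where
  "preimage_sequence I f x s \<longleftrightarrow> (\<forall>n. s n \<in> I \<and> (f ^^ n) (s n) = x)"

definition alpha_limit :: "real set \<Rightarrow> (real \<Rightarrow> real) \<Rightarrow> real \<Rightarrow> real set" where
  "alpha_limit I f x =
     {y. \<exists>s r. preimage_sequence I f x s \<and> strict_mono (r :: nat \<Rightarrow> nat) \<and> (s \<circ> r) \<longlonglongrightarrow> y}"

definition all_alpha_limits :: "real set \<Rightarrow> (real \<Rightarrow> real) \<Rightarrow> real set" where
  "all_alpha_limits I f = (\<Union>x\<in>I. alpha_limit I f x)"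

(* The branch is indexed by the non-positive integers;
   values of s at positive integers are irrelevant. *)
definition backward_orbit_branch_of ::
    "real set \<Rightarrow> (real \<Rightarrow> real) \<Rightarrow> real \<Rightarrow> (int \<Rightarrow> real) \<Rightarrow> bool" where
  "backward_orbit_branch_of I f x s \<longleftrightarrow>
     (\<forall>i\<le>0. s i \<in> I) \<and> s 0 = x \<and> (\<forall>i\<le>0. f (s (i - 1)) = s i)"

definition backward_orbit_branch :: "real set \<Rightarrow> (real \<Rightarrow> real) \<Rightarrow> (int \<Rightarrow> real) \<Rightarrow> bool" where
  "backward_orbit_branch I f s \<longleftrightarrow> (\<exists>x\<in>I. backward_orbit_branch_of I f x s)"

(* Neighbourhoods are taken relative to I and need not be open. *)
definition neighbourhood_in :: "real set \<Rightarrow> real set \<Rightarrow> real set \<Rightarrow> bool" where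
  "neighbourhood_in I A U \<longleftrightarrow>
     U \<subseteq> I \<and> (\<exists>V. openin (top_of_set I) V \<and> A \<subseteq> V \<and> V \<subseteq> U)"

end

theory Submission
  imports Defs
begin

text \<open>
  If every point off \<open>A(f)\<close> is wandering, then \<open>I - V\<close>, for an open \<open>V\<close> between \<open>A(f)\<close> and \<open>U\<close>,
  is covered by finitely many sets disjoint from all their forward images; a backward branch
  visits each of them at most once, so \<open>M\<close> can be the number of these sets.

  It remains to see that a nonwandering point \<open>y\<close> lies in some \<open>\<alpha>(x)\<close>. If \<open>y \<notin> \<alpha>(y)\<close>, then
  some compact interval \<open>W\<close> around \<open>y\<close> has \<open>y \<notin> f\<^sup>k(W)\<close> for all \<open>k \<ge> 1\<close>. Pick \<open>n \<ge> 1\<close> such that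
  \<open>f\<^sup>n(W)\<close> meets \<open>W\<close>. Then the union \<open>T\<close> of the \<open>f\<^bsup>kn\<^esup>(W)\<close>, \<open>k \<ge> 1\<close>, is an interval, and its
  closure misses \<open>y\<close>; let \<open>x \<noteq> y\<close> lie between \<open>y\<close> and \<open>T\<close>. If \<open>W'\<close> is a small interval
  around \<open>y\<close> and \<open>f\<^sup>m(W')\<close> meets \<open>W'\<close>, then the union of the \<open>f\<^bsup>im\<^esup>(W')\<close>, \<open>i \<le> n\<close>, is an interval
  that contains both \<open>y\<close> and \<open>f\<^bsup>nm\<^esup>(y) \<in> T\<close>, hence also \<open>x\<close>. As \<open>m\<close> can be chosen arbitrarily
  large, \<open>y \<in> \<alpha>(x)\<close>.
\<close>

section \<open>Iterates and a criterion for \<alpha>-limit points\<close>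

lemma funpow_image_subset:
  assumes "f ` S \<subseteq> S"
  shows "(f ^^ n) ` S \<subseteq> S"
  using assms by (induction n) auto

lemma funpow_image_eq:
  assumes "f ` S = S"
  shows "(f ^^ n) ` S = S"
proof (induction n)
  case (Suc n)
  then show ?case using assms by (metis funpow.simps(2) image_comp)
qed simp

lemma continuous_on_funpow:
  fixes f :: "'a::topological_space \<Rightarrow> 'a"
  assumes "continuous_on S f" "f ` S \<subseteq> S"
  shows "continuous_on S (f ^^ n)"
proof (induction n)
  case (Suc n)
  then have "continuous_on S (f \<circ> f ^^ n)"
    using assms(1) funpow_image_subset[OF assms(2), of n]
    by (intro continuous_on_compose) (auto intro: continuous_on_subset)
  then show ?case by simp
qed (simp add: continuous_on_id')

text \<open>Members of a preimage sequence are unrelated, so preimages near \<open>y\<close> can be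
  chosen at increasing times \<open>r k\<close> and all other times filled with arbitrary preimages,
  which exist because every iterate of \<open>f\<close> maps \<open>I\<close> onto
  \<open>I\<close>.\<close>

lemma alpha_limitI:
  assumes onto: "f ` I = I" and "x \<in> I"
    and near: "\<And>e N. e > 0 \<Longrightarrow> \<exists>n\<ge>N. \<exists>z\<in>I. dist z y < e \<and> (f ^^ n) z = x"
  shows "y \<in> alpha_limit I f x"
proof -
  define P where "P k n \<longleftrightarrow> (\<exists>z\<in>I. dist z y < inverse (real (Suc k)) \<and> (f ^^ n) z = x)" for k n
  have "\<exists>r. \<forall>k. P k (r k) \<and> r k < r (Suc k)"
  proof (rule dependent_nat_choice)
    show "\<exists>n. P 0 n"
      using near[of "inverse (real (Suc 0))" 0] unfolding P_def by auto
    show "\<exists>n'. P (Suc k) n' \<and> n < n'" for n k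
      using near[of "inverse (real (Suc (Suc k)))" "Suc n"] unfolding P_def
      by (auto simp: Suc_le_eq)
  qed
  then obtain r where r: "\<And>k. P k (r k)" "\<And>k. r k < r (Suc k)" by blast
  then have mono: "strict_mono r" by (simp add: strict_mono_Suc_iff)
  obtain z where z: "\<And>k. z k \<in> I" "\<And>k. dist (z k) y < inverse (real (Suc k))"
    "\<And>k. (f ^^ r k) (z k) = x"
    using r(1) unfolding P_def by metis
  have "\<exists>w\<in>I. (f ^^ n) w = x" for n
    using funpow_image_eq[OF onto, of n] \<open>x \<in> I\<close> by (metis imageE)
  then obtain w where w: "\<And>n. w n \<in> I" "\<And>n. (f ^^ n) (w n) = x" by metis
  define s where "s n = (if n \<in> range r then z (inv r n) else w n)" for n
  have sr: "s \<circ> r = z"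
    by (rule ext) (simp add: s_def strict_mono_imp_inj_on[OF mono])
  have "preimage_sequence I f x s"
    unfolding preimage_sequence_def
  proof
    fix n
    show "s n \<in> I \<and> (f ^^ n) (s n) = x"
      using z w strict_mono_imp_inj_on[OF mono] by (auto simp: s_def)
  qed
  moreover have "z \<longlonglongrightarrow> y"
  proof (rule metric_LIMSEQ_I)
    fix e :: real assume "e > 0"
    then obtain k where k: "inverse (real (Suc k)) < e" using reals_Archimedean by blast
    have "dist (z n) y < e" if "n \<ge> k" for n
    proof -
      have "inverse (real (Suc n)) \<le> inverse (real (Suc k))"
        using that by (intro le_imp_inverse_le) auto
      then show ?thesis using z(2)[of n] k by linarith
    qed
    then show "\<exists>k. \<forall>n\<ge>k. dist (z n) y < e" by blast
  qed
  ultimately show ?thesis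
    unfolding alpha_limit_def using mono sr by auto
qed

section \<open>Unions of iterated images of an interval\<close>

text \<open>Consecutive images overlap: if \<open>q\<close> and \<open>h q\<close> lie in
  \<open>W\<close>, then \<open>(h ^^ N) (h q)\<close> lies in the images of \<open>W\<close> under
  both \<open>h ^^ N\<close> and \<open>h ^^ Suc N\<close>.\<close>

lemma connected_Union_iterates:
  fixes h :: "'a::topological_space \<Rightarrow> 'a"
  assumes cont: "continuous_on S h" and into: "h ` S \<subseteq> S"
    and W: "W \<subseteq> S" "connected W" and meets: "h ` W \<inter> W \<noteq> {}"
  shows "connected (\<Union>i\<le>N. (h ^^ i) ` W)"
proof (induction N)
  case (Suc N)
  obtain q where q: "q \<in> W" "h q \<in> W" using meets by blast
  have "connected ((h ^^ Suc N) ` W)"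
    by (intro connected_continuous_image continuous_on_subset[OF continuous_on_funpow[OF cont into]] W)
  moreover have "(h ^^ N) (h q) \<in> (\<Union>i\<le>N. (h ^^ i) ` W)" using q by blast
  moreover have "(h ^^ N) (h q) \<in> (h ^^ Suc N) ` W"
    using q(1) by (metis funpow_Suc_right comp_apply image_eqI)
  ultimately have "connected ((\<Union>i\<le>N. (h ^^ i) ` W) \<union> (h ^^ Suc N) ` W)"
    using Suc by (intro connected_Un) auto
  then show ?case by (simp add: atMost_Suc Un_commute)
qed (use W in simp)

text \<open>Points of \<open>T\<close> close to \<open>u\<close> and \<open>w\<close> lie on both
  sides of \<open>v\<close>. It follows that \<open>closure T - T\<close> has at most two
  points.\<close>

lemma connected_closure_strict_between:
  fixes T :: "real set"
  assumes "connected T" "u \<in> closure T" "w \<in> closure T" "u < v" "v < w"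
  shows "v \<in> T"
proof -
  obtain u' where "u' \<in> T" "dist u' u < v - u"
    using assms by (metis closure_approachable diff_gt_0_iff_gt)
  moreover obtain w' where "w' \<in> T" "dist w' w < w - v"
    using assms by (metis closure_approachable diff_gt_0_iff_gt)
  ultimately show ?thesis
    using connectedD_interval[OF assms(1), of u' w' v] by (auto simp: dist_real_def)
qed

lemma notin_closure_Union_iterates:
  fixes g :: "real \<Rightarrow> real"
  assumes "compact I" and cont: "continuous_on I g" and into: "g ` I \<subseteq> I"
    and W: "W \<subseteq> I" "connected W" "compact W" "y \<in> W"
    and meets: "g ` W \<inter> W \<noteq> {}"
    and miss: "\<And>k. y \<notin> (g ^^ Suc k) ` W"
    and T: "T = (\<Union>k. (g ^^ Suc k) ` W)"
  shows "connected T" "y \<notin> closure T"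
proof -
  have TI: "T \<subseteq> I" unfolding T using funpow_image_subset[OF into] W(1) by blast
  \<comment> \<open>In this form \<open>T\<close> is a union of connected sets that all contain
    \<open>g y\<close>.\<close>
  have T_eq: "T = (\<Union>N. g ` (\<Union>i\<le>N. (g ^^ i) ` W))"
    unfolding T by (auto simp: image_UN image_comp[symmetric])
  show conn: "connected T"
    unfolding T_eq
  proof (rule connected_Union)
    fix S assume "S \<in> range (\<lambda>N. g ` (\<Union>i\<le>N. (g ^^ i) ` W))"
    then obtain N where S: "S = g ` (\<Union>i\<le>N. (g ^^ i) ` W)" by blast
    have "(\<Union>i\<le>N. (g ^^ i) ` W) \<subseteq> I" using funpow_image_subset[OF into] W(1) by blast
    then show "connected S"
      unfolding S
      by (intro connected_continuous_image connected_Union_iterates[OF cont into W(1,2) meets]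
          continuous_on_subset[OF cont])
  next
    have "g y \<in> g ` (\<Union>i\<le>N. (g ^^ i) ` W)" for N
      using W(4) by (intro imageI UN_I[of 0]) auto
    then show "\<Inter> (range (\<lambda>N. g ` (\<Union>i\<le>N. (g ^^ i) ` W))) \<noteq> {}" by blast
  qed
  have cTI: "closure T \<subseteq> I"
    using TI \<open>compact I\<close> by (simp add: closure_minimal compact_imp_closed)
  have gW: "g ` W \<subseteq> T" unfolding T by (rule subset_trans[OF _ UN_upper[of 0]]) auto
  have gT: "g ` T \<subseteq> T" 
  proof
    fix t assume "t \<in> g ` T"
    then obtain k u where u: "u \<in> W" "t = g ((g ^^ Suc k) u)" unfolding T by blast
    then have "t = (g ^^ Suc (Suc k)) u" by simp
    then show "t \<in> T" unfolding T using u(1) by blast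
  qed
  have T_sub: "T \<subseteq> g ` W \<union> g ` T"
  proof
    fix t assume "t \<in> T"
    then obtain k u where u: "u \<in> W" "t = (g ^^ Suc k) u" unfolding T by blast
    show "t \<in> g ` W \<union> g ` T"
    proof (cases k)
      case 0 then show ?thesis using u by simp
    next
      case (Suc j)
      then have "(g ^^ k) u \<in> T" unfolding T using u(1) by blast
      then show ?thesis using u(2) by simp
    qed
  qed
  have "compact (closure T)"
    using cTI \<open>compact I\<close> by (metis closed_closure compact_Int_closed inf.absorb2)
  then have "compact (g ` W \<union> g ` closure T)"
    using W(1,3) cTI by (intro compact_Un compact_continuous_image continuous_on_subset[OF cont])
  \<comment> \<open>As \<open>T\<close> contains the image of \<open>W\<close>, every point of
    \<open>closure T\<close> outside \<open>T\<close> is therefore the image of a point of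
    \<open>closure T\<close>.\<close>
  then have cl: "closure T \<subseteq> g ` W \<union> g ` closure T"
    using T_sub closure_subset[of T] by (intro closure_minimal compact_imp_closed) blast+
  have yT: "y \<notin> T" unfolding T using miss by blast
  show "y \<notin> closure T"
    \<comment> \<open>Otherwise a preimage \<open>e\<close> of \<open>y\<close> and a preimage \<open>t\<close> of \<open>e\<close> would, with \<open>y\<close>, be three distinct
      points of \<open>closure T - T\<close>, but an interval has at most two such endpoints.\<close>
  proof
    assume y: "y \<in> closure T"
    have gy: "g y \<in> T" using gW W(4) by blast
    obtain e where e: "e \<in> closure T" "g e = y" using cl y yT gW by blast
    \<comment> \<open>Since \<open>g y\<close> lies in \<open>T\<close>, but \<open>y = g e\<close>
      and \<open>e = g t\<close> do not, both \<open>e\<close> and \<open>t\<close> differ from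
      \<open>y\<close>.\<close>
    have eT: "e \<notin> T" "e \<noteq> y" using e(2) gT gy yT by auto
    obtain t where t: "t \<in> closure T" "g t = e" using cl e(1) eT(1) gW by blast
    have "t \<notin> T" "t \<noteq> y" "t \<noteq> e" using t(2) e(2) eT gT gy by auto
    then show False
      using connected_closure_strict_between[OF conn] y e(1) t(1) eT yT
      by (metis linorder_neqE)
  qed
qed

section \<open>Nonwandering points are \<alpha>-limit points\<close>

text \<open>Finitely many iterates, each continuous and moving \<open>y\<close>, also move nearby
  points away from \<open>y\<close>. This rules out close returns at positive times below
  \<open>N\<close>.\<close>

lemma iterates_away_from_nonperiodic:
  fixes f :: "'a::metric_space \<Rightarrow> 'a"
  assumes cont: "continuous_on I f" and into: "f ` I \<subseteq> I" and "y \<in> I"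
    and nonper: "\<And>j. j \<ge> 1 \<Longrightarrow> (f ^^ j) y \<noteq> y"
  shows "\<exists>d>0. \<forall>j z. 1 \<le> j \<and> j < N \<and> z \<in> I \<and> dist z y < d \<longrightarrow> d \<le> dist ((f ^^ j) z) y"
proof (induction N)
  case (Suc N)
  then obtain d where d: "d > 0"
    "\<And>j z. 1 \<le> j \<Longrightarrow> j < N \<Longrightarrow> z \<in> I \<Longrightarrow> dist z y < d \<Longrightarrow> d \<le> dist ((f ^^ j) z) y"
    by blast
  show ?case
  proof (cases "N = 0")
    case False
    define c where "c = dist ((f ^^ N) y) y / 2"
    have "c > 0" using nonper[of N] False by (simp add: c_def)
    then obtain d' where d': "d' > 0"
      "\<And>z. z \<in> I \<Longrightarrow> dist z y < d' \<Longrightarrow> dist ((f ^^ N) z) ((f ^^ N) y) < c"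
      using continuous_on_funpow[OF cont into, of N] \<open>y \<in> I\<close>
      unfolding continuous_on_iff by blast
    have "c \<le> dist ((f ^^ N) z) y" if "z \<in> I" "dist z y < d'" for z
      using d'(2)[OF that] dist_triangle[of "(f ^^ N) y" y "(f ^^ N) z"]
      by (simp add: c_def dist_commute)
    then show ?thesis
      using d d'(1) \<open>c > 0\<close>
      by (intro exI[of _ "Min {d, d', c}"]) (fastforce simp: less_Suc_eq)
  qed (auto intro: exI[of _ 1])
qed (auto intro: exI[of _ 1])

lemma connected_contains_closed_segment:
  fixes S :: "real set"
  assumes "connected S" "u \<in> S" "v \<in> S"
  shows "closed_segment u v \<subseteq> S"
proof (rule closed_segment_subset)
  show "convex S" using assms(1) by (simp add: connected_convex_1)
qed (use assms in auto)

text \<open>The interval \<open>T\<close> lies on one side of \<open>y\<close>, at distance at least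
  some \<open>d > 0\<close>; the point at distance \<open>d\<close> from \<open>y\<close> on that
  side works.\<close>

lemma point_between:
  fixes T :: "real set"
  assumes "connected T" "y \<notin> closure T"
  shows "\<exists>x. x \<noteq> y \<and> (\<forall>t\<in>T. x \<in> closed_segment y t)"
proof -
  obtain d where d: "d > 0" "\<And>t. t \<in> T \<Longrightarrow> d \<le> dist t y"
    using assms(2) unfolding closure_approachable by (meson not_less)
  have yT: "y \<notin> T" using assms(2) closure_subset by blast
  show ?thesis
  proof (cases "\<exists>t\<in>T. t > y")
    case True
    then have "t > y" if "t \<in> T" for t
      using connectedD_interval[OF assms(1), of t _ y] that yT by force
    then show ?thesis
      using d by (intro exI[of _ "y + d"]) (force simp: dist_real_def closed_segment_eq_real_ivl)
  next
    case False
    then show ?thesis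
      using d yT by (intro exI[of _ "y - d"]) (force simp: dist_real_def closed_segment_eq_real_ivl)
  qed
qed

lemma nonwandering_in_alpha_limit:
  fixes f :: "real \<Rightarrow> real"
  assumes "compact I" "connected I" and cont: "continuous_on I f" and onto: "f ` I = I"
    and "y \<in> I"
    and nonwand: "\<And>e. e > 0 \<Longrightarrow> \<exists>n\<ge>1. \<exists>z\<in>I. dist z y < e \<and> dist ((f ^^ n) z) y < e"
  shows "y \<in> all_alpha_limits I f"
proof (cases "y \<in> alpha_limit I f y")
  case True
  then show ?thesis using \<open>y \<in> I\<close> unfolding all_alpha_limits_def by blast
next
  case False
  have into: "f ` I \<subseteq> I" using onto by simp
  have nonper: "(f ^^ j) y \<noteq> y" if "j \<ge> 1" for j
  proof
    assume per: "(f ^^ j) y = y"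
    have "(f ^^ (j * N)) y = y" for N
      by (induction N) (simp_all add: per funpow_add)
    moreover have "N \<le> j * N" for N using that by simp
    ultimately have "y \<in> alpha_limit I f y"
      using \<open>y \<in> I\<close> by (intro alpha_limitI[OF onto \<open>y \<in> I\<close>]) (metis dist_self)
    with False show False ..
  qed
  have away: "\<exists>d>0. \<forall>j z. 1 \<le> j \<and> j < N \<and> z \<in> I \<and> dist z y < d \<longrightarrow> d \<le> dist ((f ^^ j) z) y" for N
    by (rule iterates_away_from_nonperiodic[OF cont into \<open>y \<in> I\<close> nonper])
  \<comment> \<open>Within the radius \<open>d\<close> no return happens before time
    \<open>N\<close>, so the one supplied by \<open>nonwand\<close> is late.\<close>
  have nonwand_large: "\<exists>n\<ge>N. \<exists>z\<in>I. dist z y < e \<and> dist ((f ^^ n) z) y < e" if "e > 0" for e N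
  proof -
    obtain d where "d > 0"
      "\<And>j z. 1 \<le> j \<Longrightarrow> j < N \<Longrightarrow> z \<in> I \<Longrightarrow> dist z y < d \<Longrightarrow> d \<le> dist ((f ^^ j) z) y"
      using away[of N] by blast
    then show ?thesis
      using nonwand[of "min d e"] that by (metis min_less_iff_conj not_less)
  qed
  \<comment> \<open>For points near \<open>y\<close>, \<open>False\<close> excludes late arrivals at
    \<open>y\<close> itself; \<open>away\<close> excludes the finitely many early ones.\<close>
  obtain e0 N0 where e0: "e0 > 0"
    "\<And>n z. n \<ge> N0 \<Longrightarrow> z \<in> I \<Longrightarrow> dist z y < e0 \<Longrightarrow> (f ^^ n) z \<noteq> y"
    using False alpha_limitI[OF onto \<open>y \<in> I\<close>, of y] by meson
  obtain d0 where d0: "d0 > 0"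
    "\<And>j z. 1 \<le> j \<Longrightarrow> j < N0 \<Longrightarrow> z \<in> I \<Longrightarrow> dist z y < d0 \<Longrightarrow> d0 \<le> dist ((f ^^ j) z) y"
    using away[of N0] by blast
  \<comment> \<open>Halving fits a closed ball, hence a compact \<open>W\<close>, inside both open
    balls.\<close>
  define r where "r = min e0 d0 / 2"
  have r: "r > 0" "r < e0" "r < d0" using e0(1) d0(1) by (auto simp: r_def)
  define W where "W = cball y r \<inter> I"
  have W: "W \<subseteq> I" "connected W" "compact W" "y \<in> W"
    using \<open>compact I\<close> \<open>connected I\<close> \<open>y \<in> I\<close> r(1)
    by (auto simp: W_def is_interval_connected_1[symmetric] is_interval_Int is_interval_cball_1
        intro: closed_Int_compact)
  have miss: "(f ^^ n) z \<noteq> y" if "n \<ge> 1" "z \<in> W" for n z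
  proof (cases "n \<ge> N0")
    case True
    then show ?thesis using e0(2)[of n z] that r by (auto simp: W_def dist_commute)
  next
    case False
    then show ?thesis using d0(1) d0(2)[of n z] that r by (auto simp: W_def dist_commute)
  qed
  obtain n q where n: "n \<ge> 1" "q \<in> I" "dist q y < r" "dist ((f ^^ n) q) y < r"
    using nonwand[OF r(1)] by blast
  define g where "g = f ^^ n"
  have g: "continuous_on I g" "g ` I \<subseteq> I"
    unfolding g_def by (rule continuous_on_funpow[OF cont into] funpow_image_subset[OF into])+
  have meets: "g ` W \<inter> W \<noteq> {}"
  proof -
    have "g q \<in> g ` W" using n by (auto simp: W_def dist_commute)
    moreover have "g q \<in> W" using n g(2) by (auto simp: W_def g_def dist_commute)
    ultimately show ?thesis by blast
  qed
  define T where "T = (\<Union>k. (g ^^ Suc k) ` W)"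
  have gpow: "g ^^ k = f ^^ (n * k)" for k unfolding g_def by (simp add: funpow_mult mult.commute)
  have "y \<notin> (g ^^ Suc k) ` W" for k
    using miss[of "n * Suc k"] n(1) unfolding gpow by auto
  note T = notin_closure_Union_iterates[OF \<open>compact I\<close> g W meets this T_def]
  obtain x where x: "x \<noteq> y" "\<And>t. t \<in> T \<Longrightarrow> x \<in> closed_segment y t"
    using point_between[OF T] by blast
  have TI: "T \<subseteq> I" unfolding T_def using funpow_image_subset[OF g(2)] W(1) by blast
  have "g y \<in> T" unfolding T_def using W(4) by (intro UN_I[of 0]) auto
  then have "x \<in> I"
    using x(2) TI \<open>y \<in> I\<close> connected_contains_closed_segment[OF \<open>connected I\<close>] by blast
  have "y \<in> alpha_limit I f x"
  proof (rule alpha_limitI[OF onto \<open>x \<in> I\<close>])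
    fix e :: real and N assume "e > 0"
    \<comment> \<open>The bound \<open>dist x y\<close> keeps \<open>x\<close> out of
      \<open>W'\<close>, so \<open>x\<close> can only be reached with \<open>i \<ge> 1\<close>, that
      is, at a time \<open>m * i \<ge> N\<close>.\<close>
    define e' where "e' = min e (dist x y)"
    have "e' > 0" using \<open>e > 0\<close> x(1) by (simp add: e'_def)
    obtain m p where m: "m \<ge> Suc N" "p \<in> I" "dist p y < e'" "dist ((f ^^ m) p) y < e'"
      using nonwand_large[OF \<open>e' > 0\<close>] by blast
    define h where "h = f ^^ m"
    have h: "continuous_on I h" "h ` I \<subseteq> I"
      unfolding h_def by (rule continuous_on_funpow[OF cont into] funpow_image_subset[OF into])+
    have hpow: "h ^^ k = f ^^ (m * k)" for k unfolding h_def by (simp add: funpow_mult mult.commute)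
    define W' where "W' = ball y e' \<inter> I"
    have W': "W' \<subseteq> I" "connected W'" "y \<in> W'"
      using \<open>connected I\<close> \<open>y \<in> I\<close> \<open>e' > 0\<close>
      by (auto simp: W'_def is_interval_connected_1[symmetric] is_interval_Int is_interval_ball_real)
    have "h ` W' \<inter> W' \<noteq> {}"
    proof -
      have "h p \<in> h ` W'" using m by (auto simp: W'_def dist_commute)
      moreover have "h p \<in> W'" using m h(2) by (auto simp: W'_def h_def dist_commute)
      ultimately show ?thesis by blast
    qed
    note conn = connected_Union_iterates[OF h W'(1,2) this, of n]
    define D where "D = (\<Union>i\<le>n. (h ^^ i) ` W')"
    \<comment> \<open>The roles of \<open>m\<close> and \<open>n\<close> are exchanged:
      \<open>n\<close> steps of \<open>h\<close> are \<open>m\<close> steps of \<open>g\<close>, and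
      \<open>m > 0\<close> puts the resulting point in \<open>T\<close>.\<close>
    obtain m' where "m = Suc m'" using m(1) by (cases m) auto
    then have "(h ^^ n) y = (g ^^ Suc m') y"
      unfolding hpow gpow by (simp add: mult.commute)
    then have "(h ^^ n) y \<in> T" unfolding T_def using W(4) by auto
    moreover have "(h ^^ n) y \<in> D" "y \<in> D"
      unfolding D_def using W'(3) by (auto intro: bexI[of _ 0])
    ultimately have "x \<in> D"
      using x(2) connected_contains_closed_segment[OF conn] unfolding D_def[symmetric] by blast
    then obtain i z where iz: "z \<in> W'" "x = (h ^^ i) z" unfolding D_def by blast
    have "i \<noteq> 0"
    proof
      assume "i = 0"
      then have "x \<in> W'" using iz by simp
      then show False by (simp add: W'_def e'_def dist_commute)
    qed
    then have "m * 1 \<le> m * i" by (intro mult_le_mono2) simp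
    then have "N \<le> m * i" using m(1) by linarith
    moreover have "z \<in> I" "dist z y < e" "(f ^^ (m * i)) z = x"
      using iz unfolding hpow by (auto simp: W'_def e'_def dist_commute)
    ultimately show "\<exists>n\<ge>N. \<exists>z\<in>I. dist z y < e \<and> (f ^^ n) z = x" by blast
  qed
  then show ?thesis using \<open>x \<in> I\<close> unfolding all_alpha_limits_def by blast
qed

section \<open>Counting the visits of a backward branch\<close>

lemma backward_orbit_branch_funpow:
  assumes "backward_orbit_branch I f s" "i \<le> 0"
  shows "(f ^^ n) (s (i - int n)) = s i"
proof (induction n)
  case (Suc n)
  have "f (s ((i - int n) - 1)) = s (i - int n)"
    using assms unfolding backward_orbit_branch_def backward_orbit_branch_of_def by auto
  moreover have "i - int (Suc n) = (i - int n) - 1" by simp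
  ultimately show ?case using Suc by (metis comp_apply funpow_Suc_right)
qed simp

theorem theorem9:
  fixes a b :: real and f :: "real \<Rightarrow> real" and I U :: "real set"
  assumes "a \<le> b" and "I = {a..b}"
    and "continuous_on I f" and "f ` I = I"
    and "neighbourhood_in I (all_alpha_limits I f) U"
  shows "\<exists>M::nat. \<forall>s. backward_orbit_branch I f s \<longrightarrow>
           finite {i::int. i \<le> 0 \<and> s i \<notin> U} \<and> card {i::int. i \<le> 0 \<and> s i \<notin> U} \<le> M"
proof -
  obtain V where V: "openin (top_of_set I) V" "all_alpha_limits I f \<subseteq> V" "V \<subseteq> U"
    using assms(5) unfolding neighbourhood_in_def by blast
  have I: "compact I" "connected I" using assms(2) by auto
  define K where "K = I - V"
  have "compact K"
  proof -
    obtain O' where "open O'" "V = I \<inter> O'" using V(1) by (auto simp: openin_open)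
    then show ?thesis unfolding K_def using compact_diff[OF I(1)] by (simp add: Diff_Int)
  qed
  \<comment> \<open>Points of \<open>K\<close> are wandering: some ball around \<open>y\<close>
    never meets its own forward images.\<close>
  have "\<exists>e>0. \<forall>n\<ge>1. \<forall>z\<in>I. dist z y < e \<longrightarrow> \<not> dist ((f ^^ n) z) y < e" if "y \<in> K" for y
    using nonwandering_in_alpha_limit[OF I assms(3,4), of y] that V(2) unfolding K_def
    by (metis Diff_iff subsetD)
  then obtain e where e: "\<And>y. y \<in> K \<Longrightarrow> e y > 0"
    "\<And>y n z. y \<in> K \<Longrightarrow> n \<ge> 1 \<Longrightarrow> z \<in> I \<Longrightarrow> dist z y < e y \<Longrightarrow> \<not> dist ((f ^^ n) z) y < e y"
    by metis
  obtain C where C: "C \<subseteq> K" "finite C" "K \<subseteq> (\<Union>y\<in>C. ball y (e y))"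
  proof (rule compactE_image[OF \<open>compact K\<close>, of K "\<lambda>y. ball y (e y)"])
    show "K \<subseteq> (\<Union>y\<in>K. ball y (e y))" using e(1) by force
  qed auto
  have "finite {i::int. i \<le> 0 \<and> s i \<notin> U} \<and> card {i::int. i \<le> 0 \<and> s i \<notin> U} \<le> card C"
    if s: "backward_orbit_branch I f s" for s
  proof -
    let ?B = "{i::int. i \<le> 0 \<and> s i \<notin> U}"
    have sI: "s i \<in> I" if "i \<le> 0" for i
      using s that unfolding backward_orbit_branch_def backward_orbit_branch_of_def by blast
    have "\<exists>y\<in>C. dist (s i) y < e y" if "i \<in> ?B" for i
    proof -
      have "s i \<in> K" using that sI V(3) unfolding K_def by blast
      then obtain y where "y \<in> C" "s i \<in> ball y (e y)" using C(3) by blast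
      then show ?thesis by (auto simp: dist_commute)
    qed
    then obtain c where c: "\<And>i. i \<in> ?B \<Longrightarrow> c i \<in> C \<and> dist (s i) (c i) < e (c i)" by metis
    \<comment> \<open>The orbit of \<open>s i\<close> reaches \<open>s j\<close> after
      \<open>j - i\<close> steps, so a common center would make its ball meet a forward image of
      itself.\<close>
    have ne: "c i \<noteq> c j" if "i \<in> ?B" "j \<in> ?B" "i < j" for i j
    proof
      assume eq: "c i = c j"
      have "j - int (nat (j - i)) = i" using that(3) by simp
      moreover have "j \<le> 0" using that(2) by simp
      ultimately have "(f ^^ nat (j - i)) (s i) = s j"
        using backward_orbit_branch_funpow[OF s, of j "nat (j - i)"] by metis
      moreover have "c i \<in> K" using c[OF that(1)] C(1) by blast
      moreover have "nat (j - i) \<ge> 1" using that(3) by simp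
      ultimately show False
        using e(2)[of "c i" "nat (j - i)" "s i"] c[OF that(1)] c[OF that(2)] sI[of i] that(1) eq
        by auto
    qed
    \<comment> \<open>Injectivity into the finite set \<open>C\<close> yields finiteness together
      with the bound.\<close>
    have "inj_on c ?B"
    proof (rule inj_onI, rule ccontr)
      fix i j assume ij: "i \<in> ?B" "j \<in> ?B" "c i = c j" "i \<noteq> j"
      show False
        using ne[OF ij(1,2)] ne[OF ij(2,1)] ij(3,4) by (cases "i < j") auto
    qed
    moreover have "c ` ?B \<subseteq> C" using c by blast
    ultimately show ?thesis
      using C(2) by (meson card_inj_on_le inj_on_finite)
  qed
  then show ?thesis by blast
qed

end
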